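(* No Mahlo cardinal is first-order theory categorical.
   Context: A cardinal $\kappa$ is first-order theory categorical if $\kappa$ is inaccessible and there is a first-order theory $T$ in the language of set theory with $V_\kappa\models T$ and $V_\lambda\not\models T$ for every inaccessible $\lambda\neq\kappa$, where $V_\kappa$ is the rank-initial segment of the cumulative hierarchy. *)

theory Defs
  imports Main "HOL-Library.Equipollence" "HOL-Library.Countable_Set"
begin

text \<open>
  The ambient universe of sets is a type satisfying the axioms of ZFC, with replacement and
  separation for arbitrary functions and subsets of the logic; choice comes from HOL. These are the
  axioms commonly used to embed ZFC in higher-order logic, here as a class instead of as
  an axiomatised type. By separation and replacement, HOL subsets of \<open>elts x\<close> and HOL functions
  between \<open>elts x\<close> and \<open>elts y\<close> amount to subsets and functions that are elements of the universe.
\<close>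

class zfc_universe =
  fixes elts :: "'a \<Rightarrow> 'a set"
  assumes extensionality: "elts x = elts y \<Longrightarrow> x = y"
    and foundation: "wf {(x, y). x \<in> elts y}"
    and infinity: "\<exists>y. elts y = range (g :: nat \<Rightarrow> 'a)"
    and union: "\<exists>y. elts y = (\<Union>z \<in> elts x. elts z)"
    and powerset: "\<exists>y. elts y = {z. elts z \<subseteq> elts x}"
    and separation: "A \<subseteq> elts x \<Longrightarrow> \<exists>y. elts y = A"
    and replacement: "\<exists>y. elts y = f ` elts x"


subsection \<open>Ordinals and large cardinals\<close>

definition transitive_set :: "'a::zfc_universe \<Rightarrow> bool" where
  "transitive_set x \<longleftrightarrow> (\<forall>y \<in> elts x. elts y \<subseteq> elts x)"

text \<open>Von Neumann ordinals; on ordinals the order is \<open>\<alpha> \<in> elts \<beta>\<close>.\<close>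

definition ordinal :: "'a::zfc_universe \<Rightarrow> bool" where
  "ordinal \<alpha> \<longleftrightarrow> transitive_set \<alpha> \<and> (\<forall>\<beta> \<in> elts \<alpha>. transitive_set \<beta>)"

definition cardinal :: "'a::zfc_universe \<Rightarrow> bool" where
  "cardinal \<kappa> \<longleftrightarrow> ordinal \<kappa> \<and> (\<forall>\<beta> \<in> elts \<kappa>. \<not> elts \<beta> \<approx> elts \<kappa>)"

definition unbounded_in :: "'a::zfc_universe set \<Rightarrow> 'a \<Rightarrow> bool" where
  "unbounded_in X \<alpha> \<longleftrightarrow> (\<forall>\<beta> \<in> elts \<alpha>. \<exists>\<gamma> \<in> X \<inter> elts \<alpha>. \<beta> \<in> elts \<gamma>)"

definition regular_cardinal :: "'a::zfc_universe \<Rightarrow> bool" where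
  "regular_cardinal \<kappa> \<longleftrightarrow> cardinal \<kappa> \<and> infinite (elts \<kappa>) \<and>
     (\<forall>X \<subseteq> elts \<kappa>. unbounded_in X \<kappa> \<longrightarrow> X \<approx> elts \<kappa>)"

definition strong_limit :: "'a::zfc_universe \<Rightarrow> bool" where
  "strong_limit \<kappa> \<longleftrightarrow> (\<forall>\<beta> \<in> elts \<kappa>. Pow (elts \<beta>) \<prec> elts \<kappa>)"

definition inaccessible :: "'a::zfc_universe \<Rightarrow> bool" where
  "inaccessible \<kappa> \<longleftrightarrow> regular_cardinal \<kappa> \<and> uncountable (elts \<kappa>) \<and> strong_limit \<kappa>"

text \<open>An ordinal in which some set is unbounded in the above (strict) sense is zero or a limit.\<close>

definition club_in :: "'a::zfc_universe set \<Rightarrow> 'a \<Rightarrow> bool" where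
  "club_in C \<kappa> \<longleftrightarrow> C \<subseteq> elts \<kappa> \<and> unbounded_in C \<kappa> \<and>
     (\<forall>\<alpha> \<in> elts \<kappa>. elts \<alpha> \<noteq> {} \<and> unbounded_in C \<alpha> \<longrightarrow> \<alpha> \<in> C)"

definition stationary_in :: "'a::zfc_universe set \<Rightarrow> 'a \<Rightarrow> bool" where
  "stationary_in S \<kappa> \<longleftrightarrow> (\<forall>C. club_in C \<kappa> \<longrightarrow> S \<inter> C \<noteq> {})"

definition Mahlo :: "'a::zfc_universe \<Rightarrow> bool" where
  "Mahlo \<kappa> \<longleftrightarrow> inaccessible \<kappa> \<and> stationary_in {\<mu> \<in> elts \<kappa>. regular_cardinal \<mu>} \<kappa>"


subsection \<open>The cumulative hierarchy\<close>

text \<open>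
  \<open>V\<^sub>\<alpha>\<close> is the union of the power sets of the \<open>V\<^sub>\<beta>\<close> with \<open>\<beta> < \<alpha>\<close>; it is represented by
  the HOL set of its elements.
\<close>

function cumul :: "'a::zfc_universe \<Rightarrow> 'a set" where
  "cumul \<alpha> = (\<Union>\<beta> \<in> elts \<alpha>. {x. elts x \<subseteq> cumul \<beta>})"
  by auto
termination
  by (relation "{(x, y). x \<in> elts y}") (auto simp: foundation)

declare cumul.simps [simp del]


subsection \<open>First-order logic in the language of set theory\<close>

datatype fm =
    Mem nat nat
  | Equal nat nat
  | Neg fm
  | Conj fm fm
  | All nat fm

fun free_vars :: "fm \<Rightarrow> nat set" where
  "free_vars (Mem i j) = {i, j}"
| "free_vars (Equal i j) = {i, j}"
| "free_vars (Neg \<phi>) = free_vars \<phi>"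
| "free_vars (Conj \<phi> \<psi>) = free_vars \<phi> \<union> free_vars \<psi>"
| "free_vars (All i \<phi>) = free_vars \<phi> - {i}"

text \<open>Satisfaction in the structure with domain \<open>M\<close> and the membership relation of the universe.\<close>

fun sat :: "'a::zfc_universe set \<Rightarrow> (nat \<Rightarrow> 'a) \<Rightarrow> fm \<Rightarrow> bool" where
  "sat M v (Mem i j) \<longleftrightarrow> v i \<in> elts (v j)"
| "sat M v (Equal i j) \<longleftrightarrow> v i = v j"
| "sat M v (Neg \<phi>) \<longleftrightarrow> \<not> sat M v \<phi>"
| "sat M v (Conj \<phi> \<psi>) \<longleftrightarrow> sat M v \<phi> \<and> sat M v \<psi>"
| "sat M v (All i \<phi>) \<longleftrightarrow> (\<forall>x \<in> M. sat M (v(i := x)) \<phi>)"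

definition fo_theory :: "fm set \<Rightarrow> bool" where
  "fo_theory T \<longleftrightarrow> (\<forall>\<phi> \<in> T. free_vars \<phi> = {})"

definition models :: "'a::zfc_universe set \<Rightarrow> fm set \<Rightarrow> bool" (infix "\<Turnstile>" 50) where
  "M \<Turnstile> T \<longleftrightarrow> (\<forall>\<phi> \<in> T. \<forall>v. range v \<subseteq> M \<longrightarrow> sat M v \<phi>)"

definition fo_theory_categorical :: "'a::zfc_universe \<Rightarrow> bool" where
  "fo_theory_categorical \<kappa> \<longleftrightarrow> inaccessible \<kappa> \<and>
     (\<exists>T. fo_theory T \<and> cumul \<kappa> \<Turnstile> T \<and>
        (\<forall>\<mu>. inaccessible \<mu> \<and> \<mu> \<noteq> \<kappa> \<longrightarrow> \<not> cumul \<mu> \<Turnstile> T))"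

end

theory Submission
  imports Defs
begin

text \<open>
  Since \<open>\<kappa>\<close> is inaccessible, the ordinals \<open>\<alpha> < \<kappa>\<close> which are closed under cardinal exponentiation and
  for which \<open>V\<^sub>\<alpha>\<close> contains witnesses for every existential statement true in \<open>V\<^sub>\<kappa>\<close> with
  parameters from some \<open>V\<^sub>\<beta>\<close>, \<open>\<beta> < \<alpha>\<close>, form a club in \<open>\<kappa>\<close>. As \<open>\<kappa>\<close> is Mahlo, this club contains a
  regular cardinal \<open>\<mu>\<close>. It is inaccessible, and \<open>V\<^sub>\<mu>\<close> is an elementary substructure of \<open>V\<^sub>\<kappa>\<close> by the
  Tarski--Vaught criterion, so every theory true in \<open>V\<^sub>\<kappa>\<close> is true in \<open>V\<^sub>\<mu>\<close>.
\<close>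

section \<open>Foundation and comparability of ordinals\<close>

lemma mem_irrefl: "x \<notin> elts (x::'a::zfc_universe)"
  using wf_not_refl[OF foundation, of x] by simp

lemma mem_induct [case_names mem]:
  assumes "\<And>x::'a::zfc_universe. (\<And>y. y \<in> elts x \<Longrightarrow> P y) \<Longrightarrow> P x"
  shows "P x"
  using wf_induct_rule[OF foundation, of P x] assms by simp

lemma ordinal_trans: "ordinal \<alpha> \<Longrightarrow> \<beta> \<in> elts \<alpha> \<Longrightarrow> elts \<beta> \<subseteq> elts \<alpha>"
  unfolding ordinal_def transitive_set_def by blast

lemma ordinal_mem: "ordinal \<alpha> \<Longrightarrow> \<beta> \<in> elts \<alpha> \<Longrightarrow> ordinal \<beta>"
  unfolding ordinal_def transitive_set_def by blast

text \<open>Double membership induction: if all three cases fail, the two induction hypotheses and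
  transitivity make each ordinal a subset of the other, so they are equal by extensionality.\<close>

lemma ordinal_linear:
  fixes \<alpha> \<beta> :: "'a::zfc_universe"
  assumes "ordinal \<alpha>" "ordinal \<beta>"
  shows "\<alpha> \<in> elts \<beta> \<or> \<alpha> = \<beta> \<or> \<beta> \<in> elts \<alpha>"
  using assms
proof (induction \<alpha> arbitrary: \<beta> rule: mem_induct)
  case (mem \<alpha>)
  note IH_\<alpha> = mem.IH and ord_\<alpha> = mem.prems(1)
  from mem.prems(2) show ?case
  proof (induction \<beta> rule: mem_induct)
    case (mem \<beta>)
    show ?case
    proof (rule ccontr)
      assume neg: "\<not> ?thesis"
      have "elts \<alpha> \<subseteq> elts \<beta>"
        using IH_\<alpha>[OF _ ordinal_mem[OF ord_\<alpha>] mem.prems] ordinal_trans[OF ord_\<alpha>] neg by blast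
      moreover have "elts \<beta> \<subseteq> elts \<alpha>"
        using mem.IH[OF _ ordinal_mem[OF mem.prems]] ordinal_trans[OF mem.prems] neg by blast
      ultimately show False
        using neg extensionality by blast
    qed
  qed
qed

text \<open>By choice any two cardinalities are comparable. This allows size bounds to be proved by
  contradiction.\<close>

lemma not_lesspoll_imp_lepoll:
  assumes "\<not> A \<prec> B"
  shows "B \<lesssim> A"
proof -
  have "A \<lesssim> B \<or> B \<lesssim> A"
    unfolding lepoll_def card_of_ordLeq by (rule ordLeq_total) (rule card_of_Well_order)+
  with assms show ?thesis
    unfolding lesspoll_def using eqpoll_sym eqpoll_imp_lepoll by blast
qed

lemma cumul_mono: "elts \<alpha> \<subseteq> elts \<beta> \<Longrightarrow> cumul \<alpha> \<subseteq> cumul \<beta>"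
  by (subst (1 2) cumul.simps) blast

lemma cumul_mem:
  assumes "\<beta> \<in> elts \<alpha>" "elts x \<subseteq> cumul \<beta>"
  shows "x \<in> cumul \<alpha>"
  using assms by (subst cumul.simps) blast

section \<open>Regular cardinals, bounded families and smaller sets\<close>

lemma regular_cardinal_ordinal: "regular_cardinal \<kappa> \<Longrightarrow> ordinal \<kappa>"
  by (simp add: regular_cardinal_def cardinal_def)

lemma inaccessible_regular: "inaccessible \<kappa> \<Longrightarrow> regular_cardinal \<kappa>"
  by (simp add: inaccessible_def)

lemma cardinal_mem_lesspoll:
  assumes "cardinal \<kappa>" "\<beta> \<in> elts \<kappa>"
  shows "elts \<beta> \<prec> elts \<kappa>"
  using assms unfolding cardinal_def lesspoll_def
  by (meson ordinal_trans subset_imp_lepoll)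

text \<open>Otherwise \<kappa> is the successor of \<beta>; being infinite, it is then equinumerous
  with \<beta>, against \<kappa> being a cardinal.\<close>

lemma regular_limit:
  assumes "regular_cardinal \<kappa>" "\<beta> \<in> elts \<kappa>"
  shows "\<exists>\<gamma> \<in> elts \<kappa>. \<beta> \<in> elts \<gamma>"
proof (rule ccontr)
  assume neg: "\<not> ?thesis"
  have ord: "ordinal \<kappa>" and inf: "infinite (elts \<kappa>)" and card: "cardinal \<kappa>"
    using assms(1) by (auto simp: regular_cardinal_def cardinal_def)
  have "elts \<kappa> = insert \<beta> (elts \<beta>)"
    using neg ordinal_linear[of \<beta>] ordinal_mem[OF ord] ordinal_trans[OF ord] assms(2) by blast
  with inf have "elts \<kappa> \<approx> elts \<beta>"
    by (metis finite_insert infinite_insert_eqpoll)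
  then show False
    using card assms(2) eqpoll_sym unfolding cardinal_def by blast
qed

text \<open>The image is smaller than \<kappa>, so regularity forbids it to be unbounded.\<close>

lemma regular_bounded:
  assumes reg: "regular_cardinal \<kappa>" and A: "A \<prec> elts \<kappa>" and f: "f ` A \<subseteq> elts \<kappa>"
  shows "\<exists>\<delta> \<in> elts \<kappa>. \<forall>a \<in> A. f a \<in> elts \<delta>"
proof -
  note ord = regular_cardinal_ordinal[OF reg]
  have "f ` A \<prec> elts \<kappa>"
    using A image_lepoll lesspoll_trans1 by blast
  then have "\<not> unbounded_in (f ` A) \<kappa>"
    using reg f unfolding regular_cardinal_def lesspoll_def by blast
  then obtain \<beta> where \<beta>: "\<beta> \<in> elts \<kappa>" "\<And>a. a \<in> A \<Longrightarrow> \<beta> \<notin> elts (f a)"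
    using f unfolding unbounded_in_def by blast
  \<comment> \<open>\<beta> is only a weak bound, since \<open>f a = \<beta>\<close> may occur;
    passing to a larger \<delta> makes it strict.\<close>
  obtain \<delta> where \<delta>: "\<delta> \<in> elts \<kappa>" "\<beta> \<in> elts \<delta>"
    using regular_limit[OF reg \<beta>(1)] by blast
  have "f a \<in> elts \<delta>" if "a \<in> A" for a
  proof -
    have "f a \<in> elts \<kappa>" using f that by blast
    then have "f a = \<beta> \<or> f a \<in> elts \<beta>"
      using ordinal_linear[of "f a" \<beta>] ordinal_mem[OF ord] \<beta> that by blast
    then show ?thesis
      using \<delta> ordinal_trans[of \<delta> \<beta>] ordinal_mem[OF ord] by blast
  qed
  with \<delta>(1) show ?thesis by blast
qed

lemma lesspoll_regular_iff:
  assumes "regular_cardinal \<kappa>"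
  shows "A \<prec> elts \<kappa> \<longleftrightarrow> (\<exists>\<delta> \<in> elts \<kappa>. A \<lesssim> elts \<delta>)"
proof
  assume A: "A \<prec> elts \<kappa>"
  then obtain f where "inj_on f A" "f ` A \<subseteq> elts \<kappa>"
    unfolding lesspoll_def lepoll_def by blast
  with regular_bounded[OF assms A] show "\<exists>\<delta> \<in> elts \<kappa>. A \<lesssim> elts \<delta>"
    unfolding lepoll_def by (metis image_subsetI)
next
  assume "\<exists>\<delta> \<in> elts \<kappa>. A \<lesssim> elts \<delta>"
  then show "A \<prec> elts \<kappa>"
    using assms cardinal_mem_lesspoll lesspoll_trans1 unfolding regular_cardinal_def by blast
qed

text \<open>A converse of \<open>regular_bounded\<close>: if A were not smaller, some f would map it
  onto \<kappa>, and a bound \<delta> would itself be a value, so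
  \<open>\<delta> \<in> elts \<delta>\<close>. Size estimates thus reduce to bounding
  functions.\<close>

lemma lesspoll_regularI:
  assumes "regular_cardinal \<kappa>"
    and bd: "\<And>f. f ` A \<subseteq> elts \<kappa> \<Longrightarrow> \<exists>\<delta> \<in> elts \<kappa>. \<forall>a \<in> A. f a \<in> elts \<delta>"
  shows "A \<prec> elts \<kappa>"
proof (rule ccontr)
  assume "\<not> A \<prec> elts \<kappa>"
  then have "elts \<kappa> \<lesssim> A" by (rule not_lesspoll_imp_lepoll)
  moreover have "elts \<kappa> \<noteq> {}"
    using assms(1) unfolding regular_cardinal_def by auto
  ultimately obtain f where f: "f ` A = elts \<kappa>"
    by (metis lepoll_def inj_on_iff_surj)
  then obtain \<delta> where "\<delta> \<in> elts \<kappa>" "\<forall>a \<in> A. f a \<in> elts \<delta>"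
    using bd[of f] by blast
  with f mem_irrefl[of \<delta>] show False by (metis imageE)
qed

text \<open>A function on the union is bounded on each piece, and these fewer than \<kappa> bounds
  are bounded in turn.\<close>

lemma UN_lesspoll_regular:
  assumes reg: "regular_cardinal \<kappa>" and I: "I \<prec> elts \<kappa>"
    and A: "\<And>i. i \<in> I \<Longrightarrow> A i \<prec> elts \<kappa>"
  shows "(\<Union>i\<in>I. A i) \<prec> elts \<kappa>"
proof (rule lesspoll_regularI[OF reg])
  fix f assume f: "f ` (\<Union>i\<in>I. A i) \<subseteq> elts \<kappa>"
  have "\<forall>i\<in>I. \<exists>\<delta> \<in> elts \<kappa>. \<forall>a \<in> A i. f a \<in> elts \<delta>"
    using f by (intro ballI regular_bounded[OF reg A]) blast+
  then obtain d where d: "\<And>i. i \<in> I \<Longrightarrow> d i \<in> elts \<kappa>" "\<And>i a. i \<in> I \<Longrightarrow> a \<in> A i \<Longrightarrow> f a \<in> elts (d i)"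
    by metis
  obtain \<delta> where \<delta>: "\<delta> \<in> elts \<kappa>" "\<forall>i\<in>I. d i \<in> elts \<delta>"
    using regular_bounded[OF reg I, of d] d(1) by blast
  then have "ordinal \<delta>"
    using ordinal_mem regular_cardinal_ordinal reg by blast
  with \<delta> d(2) show "\<exists>\<delta> \<in> elts \<kappa>. \<forall>a \<in> (\<Union>i\<in>I. A i). f a \<in> elts \<delta>"
    using ordinal_trans by blast
qed

lemma Times_lesspoll_regular:
  assumes "regular_cardinal \<kappa>" "A \<prec> elts \<kappa>" "B \<prec> elts \<kappa>"
  shows "A \<times> B \<prec> elts \<kappa>"
proof -
  have "(\<Union>a\<in>A. Pair a ` B) \<prec> elts \<kappa>"
    using assms image_lepoll lesspoll_trans1 by (intro UN_lesspoll_regular) blast+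
  moreover have "(\<Union>a\<in>A. Pair a ` B) = A \<times> B" by auto
  ultimately show ?thesis by simp
qed

section \<open>Cardinal arithmetic below an inaccessible cardinal\<close>

text \<open>The strong limit property speaks of ordinals below \<kappa> only; an embedding of A into
  such an ordinal carries it over to A.\<close>

lemma Pow_lesspoll_inaccessible:
  assumes "inaccessible \<kappa>" "A \<prec> elts \<kappa>"
  shows "Pow A \<prec> elts \<kappa>"
proof -
  obtain \<delta> where \<delta>: "\<delta> \<in> elts \<kappa>" "A \<lesssim> elts \<delta>"
    using assms lesspoll_regular_iff inaccessible_regular by blast
  then obtain f where f: "inj_on f A" "f ` A \<subseteq> elts \<delta>"
    unfolding lepoll_def by blast
  have "Pow A \<lesssim> Pow (elts \<delta>)"
    unfolding lepoll_def
  proof (intro exI conjI)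
    show "inj_on ((`) f) (Pow A)"
      using f(1) by (rule inj_on_image_Pow)
    show "(`) f ` Pow A \<subseteq> Pow (elts \<delta>)"
      using f(2) by auto
  qed
  then show ?thesis
    using assms(1) \<delta>(1) lesspoll_trans1 unfolding inaccessible_def strong_limit_def by blast
qed

lemma countable_lesspoll_inaccessible:
  assumes "inaccessible \<kappa>" "countable A"
  shows "A \<prec> elts \<kappa>"
proof (rule ccontr)
  assume "\<not> A \<prec> elts \<kappa>"
  then have "elts \<kappa> \<lesssim> A" by (rule not_lesspoll_imp_lepoll)
  then have "countable (elts \<kappa>)"
    using assms(2) by (meson countable_lepoll)
  with assms(1) show False unfolding inaccessible_def by blast
qed

text \<open>Induction along the hierarchy: by extensionality \<open>elts\<close> embeds each stage
  of the union into the power set of an earlier level, and there are fewer than \<kappa>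
  stages.\<close>

lemma cumul_lesspoll_inaccessible:
  assumes "inaccessible \<kappa>" "\<beta> \<in> elts \<kappa>"
  shows "cumul \<beta> \<prec> elts \<kappa>"
  using assms(2)
proof (induction \<beta> rule: mem_induct)
  case (mem \<beta>)
  note reg = inaccessible_regular[OF assms(1)]
  have "{x. elts x \<subseteq> cumul \<gamma>} \<prec> elts \<kappa>" if "\<gamma> \<in> elts \<beta>" for \<gamma>
  proof -
    have "\<gamma> \<in> elts \<kappa>"
      using ordinal_trans[OF regular_cardinal_ordinal[OF reg] mem.prems] that by blast
    then have "Pow (cumul \<gamma>) \<prec> elts \<kappa>"
      using mem.IH that assms(1) Pow_lesspoll_inaccessible by blast
    moreover have "{x. elts x \<subseteq> cumul \<gamma>} \<lesssim> Pow (cumul \<gamma>)"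
      unfolding lepoll_def by (rule exI[of _ elts]) (auto simp: inj_on_def intro: extensionality)
    ultimately show ?thesis using lesspoll_trans1 by blast
  qed
  moreover have "elts \<beta> \<prec> elts \<kappa>"
    using reg mem.prems cardinal_mem_lesspoll unfolding regular_cardinal_def by blast
  ultimately show ?case
    by (subst cumul.simps) (intro UN_lesspoll_regular[OF reg])
qed

text \<open>An assignment is determined by its graph, a subset of the product of the naturals with
  A.\<close>

lemma assignments_lesspoll_inaccessible:
  assumes "inaccessible \<kappa>" "A \<prec> elts \<kappa>"
  shows "{v :: nat \<Rightarrow> 'b. range v \<subseteq> A} \<prec> elts \<kappa>"
proof -
  have "(UNIV :: nat set) \<prec> elts \<kappa>"
    by (intro countable_lesspoll_inaccessible[OF assms(1)]) auto
  then have "Pow ((UNIV :: nat set) \<times> A) \<prec> elts \<kappa>"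
    using assms by (intro Pow_lesspoll_inaccessible Times_lesspoll_regular inaccessible_regular)
  moreover have "{v :: nat \<Rightarrow> 'b. range v \<subseteq> A} \<lesssim> Pow ((UNIV :: nat set) \<times> A)"
    unfolding lepoll_def
    by (rule exI[of _ "\<lambda>v. {(n, v n) | n. True}"]) (fastforce simp: inj_on_def set_eq_iff)
  ultimately show ?thesis using lesspoll_trans1 by blast
qed

section \<open>Bounding ranks in the cumulative hierarchy\<close>

lemma cumul_rank:
  assumes "regular_cardinal \<kappa>" "x \<in> cumul \<kappa>"
  shows "\<exists>\<gamma> \<in> elts \<kappa>. x \<in> cumul \<gamma>"
proof -
  obtain \<beta> where \<beta>: "\<beta> \<in> elts \<kappa>" "elts x \<subseteq> cumul \<beta>"
    using assms(2) by (subst (asm) cumul.simps) blast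
  then show ?thesis
    using regular_limit[OF assms(1)] cumul_mem by blast
qed

lemma cumul_bounded:
  assumes reg: "regular_cardinal \<kappa>" and I: "I \<prec> elts \<kappa>" and x: "\<And>i. i \<in> I \<Longrightarrow> x i \<in> cumul \<kappa>"
  shows "\<exists>\<gamma> \<in> elts \<kappa>. \<forall>i \<in> I. x i \<in> cumul \<gamma>"
proof -
  obtain r where r: "\<And>i. i \<in> I \<Longrightarrow> r i \<in> elts \<kappa>" "\<And>i. i \<in> I \<Longrightarrow> x i \<in> cumul (r i)"
    using cumul_rank[OF reg x] by metis
  obtain \<delta> where \<delta>: "\<delta> \<in> elts \<kappa>" "\<forall>i\<in>I. r i \<in> elts \<delta>"
    using regular_bounded[OF reg I, of r] r(1) by blast
  then have "ordinal \<delta>"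
    using ordinal_mem regular_cardinal_ordinal reg by blast
  then have "\<forall>i\<in>I. x i \<in> cumul \<delta>"
    using \<delta>(2) r(2) cumul_mono ordinal_trans by blast
  with \<delta>(1) show ?thesis by blast
qed

section \<open>Clubs of closure points\<close>

text \<open>For unboundedness, close off under a choice function for R in \<omega> steps; the
  supremum stays below \<kappa> because \<kappa> is regular and uncountable.\<close>

lemma club_in_closure_points:
  fixes \<kappa> :: "'a::zfc_universe"
  assumes inacc: "inaccessible \<kappa>" and R: "\<And>\<beta>. \<beta> \<in> elts \<kappa> \<Longrightarrow> \<exists>\<gamma> \<in> elts \<kappa>. R \<beta> \<gamma>"
  shows "club_in {\<alpha> \<in> elts \<kappa>. \<forall>\<beta> \<in> elts \<alpha>. \<exists>\<gamma> \<in> elts \<alpha>. R \<beta> \<gamma>} \<kappa>" (is "club_in ?C \<kappa>")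
  unfolding club_in_def
proof (intro conjI ballI impI)
  note reg = inaccessible_regular[OF inacc]
  note ord = regular_cardinal_ordinal[OF reg]
  show "?C \<subseteq> elts \<kappa>" by blast
  show "unbounded_in ?C \<kappa>"
    unfolding unbounded_in_def
  proof
    fix \<beta>0 assume \<beta>0: "\<beta>0 \<in> elts \<kappa>"
    obtain F where F: "\<And>\<beta>. \<beta> \<in> elts \<kappa> \<Longrightarrow> F \<beta> \<in> elts \<kappa>" "\<And>\<beta>. \<beta> \<in> elts \<kappa> \<Longrightarrow> R \<beta> (F \<beta>)"
      using R by metis
    have step: "\<exists>\<delta> \<in> elts \<kappa>. \<beta> \<in> elts \<delta> \<and> (\<forall>\<gamma> \<in> elts \<beta>. F \<gamma> \<in> elts \<delta>)" if \<beta>: "\<beta> \<in> elts \<kappa>" for \<beta>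
    proof -
      have "elts \<beta> \<prec> elts \<kappa>"
        using reg \<beta> cardinal_mem_lesspoll unfolding regular_cardinal_def by blast
      moreover have "F ` elts \<beta> \<subseteq> elts \<kappa>"
        using F(1) ordinal_trans[OF ord \<beta>] by blast
      ultimately obtain \<delta> where \<delta>: "\<delta> \<in> elts \<kappa>" "\<forall>\<gamma> \<in> elts \<beta>. F \<gamma> \<in> elts \<delta>"
        using regular_bounded[OF reg] by blast
      obtain \<epsilon> where \<epsilon>: "\<epsilon> \<in> elts \<kappa>" "\<delta> \<in> elts \<epsilon>"
        using regular_limit[OF reg \<delta>(1)] by blast
      obtain \<eta> where \<eta>: "\<eta> \<in> elts \<kappa>" "\<beta> \<in> elts \<eta>"
        using regular_limit[OF reg \<beta>] by blast
      \<comment> \<open>The larger of \<epsilon> and \<eta> lies above \<beta> and above all the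
        values of F on \<beta>.\<close>
      have "elts \<epsilon> \<subseteq> elts \<eta> \<or> elts \<eta> \<subseteq> elts \<epsilon>"
        using ordinal_linear[of \<epsilon> \<eta>] \<epsilon>(1) \<eta>(1) ordinal_mem[OF ord] ordinal_trans by blast
      moreover have "elts \<delta> \<subseteq> elts \<epsilon>"
        using \<epsilon> ordinal_mem[OF ord] ordinal_trans by blast
      ultimately show ?thesis
        using \<delta>(2) \<epsilon>(1) \<eta> by blast
    qed
    \<comment> \<open>The clause for \<open>n = 0\<close> in the invariant pins the start of the
      sequence to \<open>\<beta>0\<close>.\<close>
    obtain b where b0: "b 0 = \<beta>0" and b: "\<And>n. b n \<in> elts \<kappa>"
      and bS: "\<And>n. b n \<in> elts (b (Suc n)) \<and> (\<forall>\<gamma> \<in> elts (b n). F \<gamma> \<in> elts (b (Suc n)))"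
      using dependent_nat_choice[of "\<lambda>n \<beta>. \<beta> \<in> elts \<kappa> \<and> (n = 0 \<longrightarrow> \<beta> = \<beta>0)"
          "\<lambda>n \<beta> \<delta>. \<beta> \<in> elts \<delta> \<and> (\<forall>\<gamma> \<in> elts \<beta>. F \<gamma> \<in> elts \<delta>)"] step \<beta>0
      by (metis nat.distinct(1))
    have "(UNIV::nat set) \<prec> elts \<kappa>"
      by (intro countable_lesspoll_inaccessible[OF inacc]) auto
    then obtain \<delta> where \<delta>: "\<delta> \<in> elts \<kappa>" "\<forall>n. b n \<in> elts \<delta>"
      using regular_bounded[OF reg, of UNIV b] b by blast
    have ord_\<delta>: "ordinal \<delta>" using ordinal_mem[OF ord \<delta>(1)] .
    have sub: "(\<Union>n. elts (b n)) \<subseteq> elts \<delta>"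
      using \<delta>(2) ordinal_trans[OF ord_\<delta>] by blast
    \<comment> \<open>\<alpha> is the supremum of the sequence; it is a set by separation from
      \<delta>.\<close>
    then obtain \<alpha> where \<alpha>: "elts \<alpha> = (\<Union>n. elts (b n))"
      using separation by metis
    have "transitive_set \<alpha>"
      unfolding transitive_set_def \<alpha> using ordinal_trans[OF ordinal_mem[OF ord b]] by blast
    moreover have "transitive_set \<beta>" if "\<beta> \<in> elts \<alpha>" for \<beta>
      using that sub ord_\<delta> unfolding \<alpha> ordinal_def by blast
    ultimately have "ordinal \<alpha>"
      unfolding ordinal_def by blast
    \<comment> \<open>Excluding this case of comparability leaves \<alpha> at most \<delta>, hence
      below \<kappa>.\<close>
    moreover have "\<delta> \<notin> elts \<alpha>"
      using \<alpha> sub mem_irrefl by blast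
    ultimately have "\<alpha> = \<delta> \<or> \<alpha> \<in> elts \<delta>"
      using ordinal_linear ord_\<delta> by blast
    then have "\<alpha> \<in> elts \<kappa>"
      using \<delta>(1) ordinal_trans[OF ord \<delta>(1)] by blast
    moreover have "\<exists>\<gamma> \<in> elts \<alpha>. R \<beta> \<gamma>" if \<beta>: "\<beta> \<in> elts \<alpha>" for \<beta>
    proof -
      obtain n where n: "\<beta> \<in> elts (b n)" using \<beta> unfolding \<alpha> by blast
      then have "F \<beta> \<in> elts \<alpha>" using bS unfolding \<alpha> by blast
      moreover have "\<beta> \<in> elts \<kappa>" using n ordinal_trans[OF ord b] by blast
      ultimately show ?thesis using F(2) by blast
    qed
    moreover have "\<beta>0 \<in> elts \<alpha>" using bS[of 0] b0 \<alpha> by auto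
    ultimately show "\<exists>\<gamma> \<in> ?C \<inter> elts \<kappa>. \<beta>0 \<in> elts \<gamma>" by blast
  qed
  fix \<alpha> assume \<alpha>: "\<alpha> \<in> elts \<kappa>" and unb: "elts \<alpha> \<noteq> {} \<and> unbounded_in ?C \<alpha>"
  have "\<exists>\<gamma> \<in> elts \<alpha>. R \<beta> \<gamma>" if \<beta>: "\<beta> \<in> elts \<alpha>" for \<beta>
  proof -
    \<comment> \<open>A closure point \<delta> between \<beta> and \<alpha> already contains a
      witness for \<beta>.\<close>
    obtain \<delta> where "\<delta> \<in> ?C" "\<delta> \<in> elts \<alpha>" "\<beta> \<in> elts \<delta>"
      using unb \<beta> unfolding unbounded_in_def by blast
    then show ?thesis
      using ordinal_trans[OF ordinal_mem[OF ord \<alpha>]] by blast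
  qed
  with \<alpha> show "\<alpha> \<in> ?C" by blast
qed

section \<open>Closure under witnesses and elementarity\<close>

text \<open>Makes the set of formulas smaller than any inaccessible cardinal, so that witnesses for
  all formulas can be bounded at once.\<close>

instance fm :: countable
  by countable_datatype

text \<open>The first two conditions make regular closure points inaccessible; the third is the
  Tarski--Vaught condition. It asks for counterexamples because the only quantifier of
  \<open>fm\<close> is universal.\<close>

definition closure_step :: "'a::zfc_universe \<Rightarrow> 'a \<Rightarrow> 'a \<Rightarrow> bool" where
  "closure_step \<kappa> \<beta> \<gamma> \<longleftrightarrow> infinite (elts \<gamma>) \<and> Pow (elts \<beta>) \<lesssim> elts \<gamma> \<and>
     (\<forall>\<phi> i v. range v \<subseteq> cumul \<beta> \<and> (\<exists>x \<in> cumul \<kappa>. \<not> sat (cumul \<kappa>) (v(i := x)) \<phi>) \<longrightarrow>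
        (\<exists>x \<in> cumul \<gamma>. \<not> sat (cumul \<kappa>) (v(i := x)) \<phi>))"

text \<open>Each of the three conditions is met by some ordinal below \<kappa>, and all persist
  upwards. For the third, there are fewer than \<kappa> triples of formula, variable and assignment,
  so the ranks of chosen counterexamples are bounded.\<close>

lemma closure_step_exists:
  assumes inacc: "inaccessible \<kappa>" and \<beta>: "\<beta> \<in> elts \<kappa>"
  shows "\<exists>\<gamma> \<in> elts \<kappa>. closure_step \<kappa> \<beta> \<gamma>"
proof -
  note reg = inaccessible_regular[OF inacc]
  note ord = regular_cardinal_ordinal[OF reg]
  have "(UNIV::nat set) \<prec> elts \<kappa>"
    by (intro countable_lesspoll_inaccessible[OF inacc]) auto
  then obtain \<gamma>1 where \<gamma>1: "\<gamma>1 \<in> elts \<kappa>" "(UNIV::nat set) \<lesssim> elts \<gamma>1"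
    using lesspoll_regular_iff[OF reg] by blast
  have "Pow (elts \<beta>) \<prec> elts \<kappa>"
    using inacc \<beta> unfolding inaccessible_def strong_limit_def by blast
  then obtain \<gamma>2 where \<gamma>2: "\<gamma>2 \<in> elts \<kappa>" "Pow (elts \<beta>) \<lesssim> elts \<gamma>2"
    using lesspoll_regular_iff[OF reg] by blast
  define Q where "Q = (\<lambda>(\<phi>, i, v) x. x \<in> cumul \<kappa> \<and> \<not> sat (cumul \<kappa>) (v(i := x)) \<phi>)"
  \<comment> \<open>Only triples that have a counterexample in \<open>cumul \<kappa>\<close> are
    kept, so the choice \<open>w\<close> below is meaningful on all of \<open>I\<close>.\<close>
  define I where "I = {p \<in> (UNIV :: fm set) \<times> (UNIV :: nat set) \<times> {v. range v \<subseteq> cumul \<beta>}. \<exists>x. Q p x}"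
  have "(UNIV :: fm set) \<times> (UNIV :: nat set) \<times> {v :: nat \<Rightarrow> 'a. range v \<subseteq> cumul \<beta>} \<prec> elts \<kappa>"
    using inacc \<beta> by (intro Times_lesspoll_regular[OF reg] countable_lesspoll_inaccessible
        assignments_lesspoll_inaccessible cumul_lesspoll_inaccessible) auto
  then have I: "I \<prec> elts \<kappa>"
    unfolding I_def by (rule lesspoll_trans1[OF subset_imp_lepoll, rotated]) blast
  define w where "w p = (SOME x. Q p x)" for p
  have w: "Q p (w p)" if "p \<in> I" for p
  proof -
    have "\<exists>x. Q p x" using that unfolding I_def by blast
    then show ?thesis unfolding w_def by (rule someI_ex)
  qed
  have "\<exists>\<gamma> \<in> elts \<kappa>. \<forall>p \<in> I. w p \<in> cumul \<gamma>"
  proof (rule cumul_bounded[OF reg I])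
    fix p assume "p \<in> I"
    then show "w p \<in> cumul \<kappa>"
      using w[of p] unfolding Q_def by (simp add: case_prod_beta)
  qed
  then obtain \<gamma>3 where \<gamma>3: "\<gamma>3 \<in> elts \<kappa>" "\<forall>p \<in> I. w p \<in> cumul \<gamma>3"
    by blast
  have "{\<gamma>1, \<gamma>2, \<gamma>3} \<prec> elts \<kappa>"
    by (intro countable_lesspoll_inaccessible[OF inacc]) auto
  then obtain \<gamma> where \<gamma>: "\<gamma> \<in> elts \<kappa>" "\<gamma>1 \<in> elts \<gamma>" "\<gamma>2 \<in> elts \<gamma>" "\<gamma>3 \<in> elts \<gamma>"
    using regular_bounded[OF reg, of "{\<gamma>1, \<gamma>2, \<gamma>3}" id] \<gamma>1(1) \<gamma>2(1) \<gamma>3(1) by auto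
  then have sub: "elts \<gamma>1 \<subseteq> elts \<gamma>" "elts \<gamma>2 \<subseteq> elts \<gamma>" "elts \<gamma>3 \<subseteq> elts \<gamma>"
    using ordinal_trans ordinal_mem[OF ord] by blast+
  have "infinite (elts \<gamma>)"
    using \<gamma>1(2) sub(1) unfolding infinite_le_lepoll[symmetric] by (meson finite_subset)
  moreover have "Pow (elts \<beta>) \<lesssim> elts \<gamma>"
    using \<gamma>2(2) sub(2) lepoll_trans subset_imp_lepoll by blast
  moreover have "\<exists>x \<in> cumul \<gamma>. \<not> sat (cumul \<kappa>) (v(i := x)) \<phi>"
    if "range v \<subseteq> cumul \<beta>" "\<exists>x \<in> cumul \<kappa>. \<not> sat (cumul \<kappa>) (v(i := x)) \<phi>" for \<phi> i v
  proof -
    have p: "(\<phi>, i, v) \<in> I"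
      using that unfolding I_def Q_def by auto
    show ?thesis
      using w[OF p] \<gamma>3(2) p cumul_mono[OF sub(3)] unfolding Q_def by auto
  qed
  ultimately show ?thesis
    using \<gamma>(1) unfolding closure_step_def by blast
qed

text \<open>Power sets of smaller ordinals embed into smaller ordinals, which gives the strong limit
  property.\<close>

lemma closure_point_inaccessible:
  assumes reg: "regular_cardinal \<mu>"
    and cl: "\<And>\<beta>. \<beta> \<in> elts \<mu> \<Longrightarrow> \<exists>\<gamma> \<in> elts \<mu>. closure_step \<kappa> \<beta> \<gamma>"
  shows "inaccessible \<mu>"
proof -
  have Pow_less: "Pow (elts \<beta>) \<prec> elts \<mu>" if "\<beta> \<in> elts \<mu>" for \<beta>
    using cl[OF that] lesspoll_regular_iff[OF reg] unfolding closure_step_def by blast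
  have "elts \<mu> \<noteq> {}"
    using reg unfolding regular_cardinal_def by auto
  then obtain \<gamma> where \<gamma>: "\<gamma> \<in> elts \<mu>" "infinite (elts \<gamma>)"
    using cl unfolding closure_step_def by blast
  \<comment> \<open>By Cantor, the naturals embed into \<gamma>, which is smaller than its power
    set, which is smaller than \<mu>.\<close>
  have "(UNIV :: nat set) \<prec> elts \<mu>"
    using \<gamma>(2) Pow_less[OF \<gamma>(1)] lesspoll_Pow_self
    by (meson infinite_le_lepoll lesspoll_trans lesspoll_trans1)
  then have "uncountable (elts \<mu>)"
    by (meson countableE lepoll_def lesspoll_not_refl lesspoll_trans2 subset_UNIV)
  with reg Pow_less show ?thesis
    unfolding inaccessible_def strong_limit_def by blast
qed

text \<open>The Tarski--Vaught criterion, by induction on the formula; only the quantifier case has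
  content.\<close>

lemma closure_point_elementary:
  assumes inacc: "inaccessible \<mu>" and sub: "elts \<mu> \<subseteq> elts \<kappa>"
    and cl: "\<And>\<beta>. \<beta> \<in> elts \<mu> \<Longrightarrow> \<exists>\<gamma> \<in> elts \<mu>. closure_step \<kappa> \<beta> \<gamma>"
    and v: "range v \<subseteq> cumul \<mu>"
  shows "sat (cumul \<mu>) v \<phi> \<longleftrightarrow> sat (cumul \<kappa>) v \<phi>"
  using v
proof (induction \<phi> arbitrary: v)
  case (All i \<phi>)
  note reg = inaccessible_regular[OF inacc]
  have IH: "sat (cumul \<mu>) (v(i := x)) \<phi> \<longleftrightarrow> sat (cumul \<kappa>) (v(i := x)) \<phi>" if "x \<in> cumul \<mu>" for x
    using All.prems that by (intro All.IH) auto
  have "(UNIV::nat set) \<prec> elts \<mu>"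
    by (intro countable_lesspoll_inaccessible[OF inacc]) auto
  \<comment> \<open>An assignment may take infinitely many values, but countably many ranks are
    bounded below the regular uncountable \<mu>. So \<beta> is a level at which the closure step
    applies to v.\<close>
  then obtain \<beta> where \<beta>: "\<beta> \<in> elts \<mu>" "range v \<subseteq> cumul \<beta>"
    using cumul_bounded[OF reg, of UNIV v] All.prems by blast
  obtain \<gamma> where \<gamma>: "\<gamma> \<in> elts \<mu>" "closure_step \<kappa> \<beta> \<gamma>"
    using cl[OF \<beta>(1)] by blast
  have "cumul \<gamma> \<subseteq> cumul \<mu>"
    using cumul_mono ordinal_trans[OF regular_cardinal_ordinal[OF reg] \<gamma>(1)] by blast
  \<comment> \<open>A counterexample in \<open>cumul \<kappa>\<close> yields one in
    \<open>cumul \<gamma>\<close>, hence in \<open>cumul \<mu>\<close>; the converse is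
    inclusion.\<close>
  then have "(\<forall>x \<in> cumul \<mu>. sat (cumul \<kappa>) (v(i := x)) \<phi>) \<longleftrightarrow>
      (\<forall>x \<in> cumul \<kappa>. sat (cumul \<kappa>) (v(i := x)) \<phi>)"
    using \<gamma>(2) \<beta>(2) cumul_mono[OF sub] unfolding closure_step_def by blast
  with IH show ?case by simp
qed simp_all

theorem theorem10:
  fixes \<kappa> :: "'a::zfc_universe"
  assumes "Mahlo \<kappa>"
  shows "\<not> fo_theory_categorical \<kappa>"
proof
  assume "fo_theory_categorical \<kappa>"
  then obtain T where T: "cumul \<kappa> \<Turnstile> T"
    and cat: "\<And>\<mu>. inaccessible \<mu> \<Longrightarrow> \<mu> \<noteq> \<kappa> \<Longrightarrow> \<not> cumul \<mu> \<Turnstile> T"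
    unfolding fo_theory_categorical_def by blast
  have inacc: "inaccessible \<kappa>"
    using assms unfolding Mahlo_def by blast
  \<comment> \<open>Stationarity of the regular cardinals, applied to the club of closure points of
    \<open>closure_step \<kappa>\<close>.\<close>
  obtain \<mu> where \<mu>: "\<mu> \<in> elts \<kappa>" "regular_cardinal \<mu>"
    and cl: "\<And>\<beta>. \<beta> \<in> elts \<mu> \<Longrightarrow> \<exists>\<gamma> \<in> elts \<mu>. closure_step \<kappa> \<beta> \<gamma>"
    using assms club_in_closure_points[of \<kappa> "closure_step \<kappa>", OF inacc closure_step_exists[OF inacc]]
    unfolding Mahlo_def stationary_in_def by blast
  have inacc_\<mu>: "inaccessible \<mu>"
    using closure_point_inaccessible[OF \<mu>(2) cl] .
  have sub: "elts \<mu> \<subseteq> elts \<kappa>"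
    using ordinal_trans[OF regular_cardinal_ordinal[OF inaccessible_regular[OF inacc]] \<mu>(1)] .
  have "cumul \<mu> \<Turnstile> T"
    unfolding models_def
  proof (intro ballI allI impI)
    fix \<phi> and v :: "nat \<Rightarrow> 'a" assume "\<phi> \<in> T" and v: "range v \<subseteq> cumul \<mu>"
    \<comment> \<open>An assignment into \<open>cumul \<mu>\<close> is also one into
      \<open>cumul \<kappa>\<close>, where T holds.\<close>
    then have "sat (cumul \<kappa>) v \<phi>"
      using T cumul_mono[OF sub] unfolding models_def by (meson subset_trans)
    then show "sat (cumul \<mu>) v \<phi>"
      using closure_point_elementary[OF inacc_\<mu> sub cl v] by simp
  qed
  moreover have "\<mu> \<noteq> \<kappa>"
    using \<mu>(1) mem_irrefl by blast
  ultimately show False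
    using cat inacc_\<mu> by blast
qed

end
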